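(* Let $\xi^t$ be a locally interacting, particle-number-conserving, discrete time particle system on $X=\mathcal{A}^{\mathbb{Z}^d}$, $\mathcal{A}=\{0,1,\dots,|\mathcal{A}|-1\}$, with translation invariant transition probabilities and the Feller property. Then for each $r\in[0,|\mathcal{A}|-1]$ there exists a probability measure $\mu_r$ on $X$ which is translation invariant in space and invariant in time for $\xi^t$, and such that $\rho(\mu_r)=r$.
   Context: $\mathcal{A}$ is finite, $X=\mathcal{A}^{\mathbb{Z}^d}$ has the product topology and Borel sigma-algebra $\mathcal{B}$; $x_i\in\mathcal{A}$ is the number of particles of configuration $x$ at site $i$; $|\ell|:=\max_i|\ell_i|$ for $\ell\in\mathbb{Z}^d$; $(\sigma^\ell x)_i:=x_{i+\ell}$. The particle system is a Markov chain $\xi^t$, $t=0,1,2,\dots$, on $X$ of the following kind. At each time step all particles try to move simultaneously: for each particle at a site $i$ a velocity $v_i\in\mathbb{Z}^d$ with $|v_i|\le V<\infty$ is chosen by a (random or deterministic) procedure not depending on time or on the configuration; then a local admissibility condition, depending only on the present positions of the particles in the $2V$-neighborhood of $i$, is checked; the particle moves to $i+v_i$ if the condition holds and stays at $i$ otherwise. Thus particles are neither created nor destroyed, and each particle is displaced by at most $V$ in one step. The one-step transition probability $P(x,A)$ satisfies $P(x,A)=P(\sigma^\ell x,\sigma^\ell A)$ for all $x\in X$, $A\in\mathcal{B}$, $\ell\in\mathbb{Z}^d$, and the chain is Feller (its Markov operator maps bounded continuous functions to bounded continuous functions). $P_*\mu(A)=\int P(x,A)\,d\mu(x)$, and $\mu$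 is invariant in time if $P_*\mu=\mu$. The particle density of a translation invariant probability measure $\mu$ is $\rho(\mu):=\mu(x_0)=\int x_0\,d\mu(x)$, the expected number of particles at the origin. *)

theory Defs
  imports "HOL-Analysis.Analysis" "HOL-Probability.Probability"
begin

text \<open>
  The lattice \<open>\<int>\<^sup>d\<close> is the type \<open>int ^ 'd\<close>, and the alphabet of size \<open>K\<close> is \<open>{..<K}\<close>, so that
  \<open>x i\<close> is the number of particles of the configuration \<open>x\<close> at the site \<open>i\<close>.
\<close>

type_synonym 'd config = "int ^ 'd \<Rightarrow> nat"

definition sup_abs :: "int ^ 'd::finite \<Rightarrow> int" where
  "sup_abs l = Max (range (\<lambda>c. \<bar>l $ c\<bar>))"

definition configs :: "nat \<Rightarrow> 'd::finite config set" where
  "configs K = {x. \<forall>i. x i < K}"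

text \<open>
  The topology of the function type is the product topology, and that of \<^typ>\<open>nat\<close> is discrete.
  Hence the subspace topology of \<open>configs K\<close> is the product topology of the finite discrete
  alphabets, and the following is its Borel sigma-algebra (as a measurable space).
\<close>

definition config_space :: "nat \<Rightarrow> 'd::finite config measure" where
  "config_space K = restrict_space borel (configs K)"

definition shift :: "int ^ 'd::finite \<Rightarrow> 'd config \<Rightarrow> 'd config" where
  "shift l x = (\<lambda>i. x (i + l))"


text \<open>
  The particles at a site \<open>i\<close> of a configuration \<open>x\<close> are labelled \<open>(i, k)\<close> with \<open>k < x i\<close>.  A velocity
  field assigns a velocity to every possible label; a particle's velocity is thereby chosen
  independently of the configuration, and the values at unoccupied labels are ignored.
  The law of a velocity field is an arbitrary probability measure on the following space: velocities
  of different particles may be correlated, and a Dirac measure gives the deterministic case.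
\<close>

type_synonym 'd velocities = "(int ^ 'd) \<times> nat \<Rightarrow> int ^ 'd"

definition velocity_space :: "nat \<Rightarrow> 'd::finite velocities measure" where
  "velocity_space V = (\<Pi>\<^sub>M p\<in>UNIV. count_space {u. sup_abs u \<le> int V})"

text \<open>
  \<open>adm i k u x\<close>: in the configuration \<open>x\<close>, the \<open>k\<close>-th particle at \<open>i\<close> is allowed to make the
  attempted displacement \<open>u\<close>.
\<close>

type_synonym 'd admissibility = "int ^ 'd \<Rightarrow> nat \<Rightarrow> int ^ 'd \<Rightarrow> 'd config \<Rightarrow> bool"

definition local_admissibility :: "nat \<Rightarrow> nat \<Rightarrow> 'd::finite admissibility \<Rightarrow> bool" where
  "local_admissibility K V adm \<longleftrightarrow>
     (\<forall>i k u. \<forall>x\<in>configs K. \<forall>y\<in>configs K.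
        (\<forall>j. sup_abs (j - i) \<le> 2 * int V \<longrightarrow> x j = y j) \<longrightarrow> adm i k u x = adm i k u y)"

definition new_site ::
  "'d::finite admissibility \<Rightarrow> 'd velocities \<Rightarrow> 'd config \<Rightarrow> (int ^ 'd) \<times> nat \<Rightarrow> int ^ 'd" where
  "new_site adm v x = (\<lambda>(i, k). if adm i k (v (i, k)) x then i + v (i, k) else i)"

text \<open>
  The set of particles below is finite whenever \<open>v\<close> is bounded, as it is on \<open>velocity_space V\<close>.
\<close>

definition move_particles ::
  "'d::finite admissibility \<Rightarrow> 'd velocities \<Rightarrow> 'd config \<Rightarrow> 'd config" where
  "move_particles adm v x = (\<lambda>j. card {(i, k). k < x i \<and> new_site adm v x (i, k) = j})"


definition markov_kernel :: "nat \<Rightarrow> ('d::finite config \<Rightarrow> 'd config measure) \<Rightarrow> bool" where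
  "markov_kernel K P \<longleftrightarrow> P \<in> config_space K \<rightarrow>\<^sub>M prob_algebra (config_space K)"

text \<open>
  For a Markov kernel \<open>P\<close>, the case \<open>A = configs K\<close> says that almost surely no site receives more
  than \<open>K - 1\<close> particles; this restricts \<open>Q\<close> and \<open>adm\<close>.
\<close>

definition particle_system :: "nat \<Rightarrow> nat \<Rightarrow> ('d::finite config \<Rightarrow> 'd config measure) \<Rightarrow> bool" where
  "particle_system K V P \<longleftrightarrow>
     markov_kernel K P \<and>
     (\<exists>Q adm. prob_space Q \<and> sets Q = sets (velocity_space V) \<and>
        local_admissibility K V adm \<and>
        (\<forall>x\<in>configs K. \<forall>A\<in>sets (config_space K).
           measure (P x) A = measure Q {v \<in> space Q. move_particles adm v x \<in> A}))"

definition translation_invariant_kernel ::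
  "nat \<Rightarrow> ('d::finite config \<Rightarrow> 'd config measure) \<Rightarrow> bool" where
  "translation_invariant_kernel K P \<longleftrightarrow>
     (\<forall>x\<in>configs K. \<forall>A\<in>sets (config_space K). \<forall>l.
        measure (P x) A = measure (P (shift l x)) (shift l ` A))"

definition feller :: "nat \<Rightarrow> ('d::finite config \<Rightarrow> 'd config measure) \<Rightarrow> bool" where
  "feller K P \<longleftrightarrow>
     (\<forall>f :: 'd config \<Rightarrow> real. continuous_on (configs K) f \<and> bounded (f ` configs K) \<longrightarrow>
        continuous_on (configs K) (\<lambda>x. \<integral>y. f y \<partial>P x) \<and>
        bounded ((\<lambda>x. \<integral>y. f y \<partial>P x) ` configs K))"


definition config_prob :: "nat \<Rightarrow> 'd::finite config measure \<Rightarrow> bool" where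
  "config_prob K \<mu> \<longleftrightarrow> prob_space \<mu> \<and> sets \<mu> = sets (config_space K)"

definition translation_invariant :: "'d::finite config measure \<Rightarrow> bool" where
  "translation_invariant \<mu> \<longleftrightarrow> (\<forall>l. distr \<mu> \<mu> (shift l) = \<mu>)"

text \<open>For a Markov kernel \<open>P\<close>, the Giry bind \<open>\<mu> \<bind> P\<close> is the measure
  \<open>A \<mapsto> \<integral> P(x, A) d\<mu>(x)\<close>, that is, the image of \<open>\<mu>\<close> after one time step.\<close>

definition time_invariant ::
  "('d::finite config \<Rightarrow> 'd config measure) \<Rightarrow> 'd config measure \<Rightarrow> bool" where
  "time_invariant P \<mu> \<longleftrightarrow> \<mu> \<bind> P = \<mu>"

definition particle_density :: "'d::finite config measure \<Rightarrow> real" where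
  "particle_density \<mu> = (\<integral>x. real (x 0) \<partial>\<mu>)"

end

theory Submission
  imports Defs "HOL-Real_Asymp.Real_Asymp"
begin

text \<open>
  A time step maps the set of translation invariant measures of a given particle density into
  itself.  Invariance is kept because the transition probabilities commute with translations
  (\<open>translation_invariant_bind\<close>).  The density is kept because particles are conserved and have
  bounded speed: between two time steps, the number of particles in a cube of side \<open>n\<close> changes
  only through a boundary layer of volume \<open>O(n ^ (d - 1))\<close>, so the mean number per site changes by
  \<open>O(1 / n)\<close> for every \<open>n\<close>, that is, not at all (\<open>particle_density_bind\<close>).

  Hence one may start the chain from any translation invariant measure of density \<open>r\<close>, for instance
  a mixture of the empty and the full configuration, and average its laws over time as in the
  Krylov--Bogolyubov theorem (\<open>invariant_measure_with_conserved_integrals\<close>).  Configurations form a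
  compact space, so some subsequence of the averages converges weakly, and its limit is invariant in
  time by the Feller property.  Translation invariance and density are expressed by integrals
  of continuous functions, so they survive in the limit.

  The weak compactness of the probability measures is obtained by embedding the configuration
  space into the line by digit expansions (\<open>compact_in_line_configs\<close>) and applying Helly's selection
  theorem there (\<open>weakly_convergent_subsequence\<close>).
\<close>

section \<open>Probability measures on a compact space embedded in the line\<close>

text \<open>
  A probability measure on the measurable space \<open>M\<close> is written as an element of
  \<open>space (prob_algebra M)\<close> from here on, since this is the form in which Markov kernels take their
  values.
\<close>
lemma bind_in_space_prob_algebra:
  assumes N: "N \<in> space (prob_algebra L)" and P: "P \<in> L \<rightarrow>\<^sub>M prob_algebra L'"
  shows "N \<bind> P \<in> space (prob_algebra L')"
  unfolding space_prob_algebra using prob_space_bind'[OF N P] sets_bind'[OF N P] by blast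

text \<open>
  A continuous injection of a compact space into the line is a homeomorphism onto its image, which
  is a compact set of reals.  Probability measures on the space thereby become compactly supported
  distributions on the line, and the theorems of Levy and Helly become available for them.
\<close>
locale compact_in_line =
  fixes S :: "'a::topological_space set" and \<phi> :: "'a \<Rightarrow> real"
  assumes compact_S: "compact S"
    and nonempty_S: "S \<noteq> {}"
    and continuous_\<phi>: "continuous_on S \<phi>"
    and inj_\<phi>: "inj_on \<phi> S"
begin

abbreviation borel_S :: "'a measure" where
  "borel_S \<equiv> restrict_space borel S"

text \<open>
  The inverse of \<open>\<phi>\<close>, made total so that it can push forward measures that live on the whole line.
  Outside the image of \<open>\<phi>\<close> it only has to take a measurable value inside \<open>S\<close>.
\<close>
definition pull_back :: "real \<Rightarrow> 'a" where
  "pull_back t = (if t \<in> \<phi> ` S then the_inv_into S \<phi> t else (SOME x. x \<in> S))"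

lemma pull_back_\<phi>: "x \<in> S \<Longrightarrow> pull_back (\<phi> x) = x"
  by (simp add: pull_back_def the_inv_into_f_f[OF inj_\<phi>])

lemma pull_back_in_S: "pull_back t \<in> S"
  using nonempty_S by (auto simp: pull_back_def the_inv_into_f_f[OF inj_\<phi>] some_in_eq)

lemma compact_image_\<phi>: "compact (\<phi> ` S)"
  using compact_continuous_image[OF continuous_\<phi> compact_S] .

lemma continuous_pull_back: "continuous_on (\<phi> ` S) pull_back"
  using continuous_on_inv[OF continuous_\<phi> compact_S] pull_back_\<phi> by blast

lemma measurable_pull_back: "pull_back \<in> borel \<rightarrow>\<^sub>M borel_S"
proof (rule measurable_restrict_space2)
  have "closed (\<phi> ` S)"
    using compact_image_\<phi> by (rule compact_imp_closed)
  moreover have "continuous_on (- \<phi> ` S) (\<lambda>t. SOME x. x \<in> S)"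
    by (rule continuous_on_const)
  moreover have "continuous_on (\<phi> ` S) (the_inv_into S \<phi>)"
    using continuous_pull_back by (rule continuous_on_eq) (simp add: pull_back_def)
  ultimately show "pull_back \<in> borel \<rightarrow>\<^sub>M borel"
    unfolding pull_back_def
    by (intro borel_measurable_continuous_on_if) auto
qed (use pull_back_in_S in auto)

lemma measurable_continuous:
  "continuous_on S f \<Longrightarrow> f \<in> borel_measurable borel_S"
  by (rule borel_measurable_continuous_on_restrict)

lemma continuous_bounded:
  fixes f :: "'a \<Rightarrow> real"
  assumes "continuous_on S f"
  obtains B where "0 \<le> B" "\<And>x. x \<in> S \<Longrightarrow> \<bar>f x\<bar> \<le> B"
proof -
  have "bounded (f ` S)"
    using compact_continuous_image[OF assms compact_S] by (rule compact_imp_bounded)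
  then obtain B where "\<And>x. x \<in> S \<Longrightarrow> \<bar>f x\<bar> \<le> B"
    by (auto simp: bounded_iff)
  then show thesis
    using that[of B] nonempty_S by (metis abs_ge_zero equals0I order_trans)
qed

lemma space_prob_borel_S:
  "N \<in> space (prob_algebra borel_S) \<Longrightarrow> space N = S"
  by (auto simp: space_prob_algebra dest: sets_eq_imp_space_eq simp: space_restrict_space)

lemma measurable_prob_borel_S:
  fixes f :: "'a \<Rightarrow> 'b::topological_space"
  assumes "N \<in> space (prob_algebra borel_S)" "continuous_on S f"
  shows "f \<in> borel_measurable N"
  using assms measurable_continuous[of f]
  by (auto simp: space_prob_algebra cong: measurable_cong_sets)

lemma integrable_continuous:
  fixes f :: "'a \<Rightarrow> real"
  assumes N: "N \<in> space (prob_algebra borel_S)" and f: "continuous_on S f"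
  shows "integrable N f"
proof -
  interpret prob_space N using N by (simp add: space_prob_algebra)
  obtain B where "\<And>x. x \<in> S \<Longrightarrow> \<bar>f x\<bar> \<le> B"
    using continuous_bounded[OF f] by blast
  then show ?thesis
    using measurable_prob_borel_S[OF N f] space_prob_borel_S[OF N]
    by (intro integrable_const_bound[where B=B]) auto
qed

text \<open>
  The functions \<open>cos (t * \<phi> x)\<close> and \<open>sin (t * \<phi> x)\<close> are continuous on \<open>S\<close>, so the continuous
  integrals determine the characteristic function of the image under \<open>\<phi>\<close>.  By Levy's uniqueness
  theorem they determine this image, and \<open>pull_back\<close> recovers the measure from it.
\<close>
lemma prob_eqI_continuous:
  assumes N: "N \<in> space (prob_algebra borel_S)" and N': "N' \<in> space (prob_algebra borel_S)"
    and eq: "\<And>f :: 'a \<Rightarrow> real. continuous_on S f \<Longrightarrow> (\<integral>x. f x \<partial>N) = (\<integral>x. f x \<partial>N')"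
  shows "N = N'"
proof -
  have cont: "continuous_on S (\<lambda>x. cos (t * \<phi> x))" "continuous_on S (\<lambda>x. sin (t * \<phi> x))" for t
    using continuous_on_compose2[OF continuous_on_cos[OF continuous_on_id] continuous_on_mult_left[OF continuous_\<phi>]]
      continuous_on_compose2[OF continuous_on_sin[OF continuous_on_id] continuous_on_mult_left[OF continuous_\<phi>]]
    by auto
  have char: "char (distr L borel \<phi>) t = (\<integral>x. cos (t * \<phi> x) \<partial>L) + \<i> * (\<integral>x. sin (t * \<phi> x) \<partial>L)"
    if L: "L \<in> space (prob_algebra borel_S)" for L t
  proof -
    have "char (distr L borel \<phi>) t
        = (CLINT x|L. of_real (cos (t * \<phi> x)) + \<i> * of_real (sin (t * \<phi> x)))"
      unfolding char_def
      by (subst integral_distr)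
         (auto simp: measurable_prob_borel_S[OF L continuous_\<phi>] exp_Euler cos_of_real sin_of_real
               simp flip: of_real_mult)
    also have "\<dots> = (\<integral>x. cos (t * \<phi> x) \<partial>L) + \<i> * (\<integral>x. sin (t * \<phi> x) \<partial>L)"
      by (subst Bochner_Integration.integral_add)
         (auto intro!: integrable_continuous[OF L] cont integrable_of_real integrable_mult_right)
    finally show ?thesis .
  qed
  have pull: "distr (distr L borel \<phi>) borel_S pull_back = L"
    if L: "L \<in> space (prob_algebra borel_S)" for L
  proof -
    have "distr (distr L borel \<phi>) borel_S pull_back = distr L borel_S (\<lambda>x. pull_back (\<phi> x))"
      by (subst distr_distr)
         (auto simp: measurable_prob_borel_S[OF L continuous_\<phi>] measurable_pull_back comp_def)
    also have "\<dots> = distr L L (\<lambda>x. x)"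
      using L space_prob_borel_S[OF L]
      by (intro distr_cong) (auto simp: space_prob_algebra pull_back_\<phi>)
    finally show ?thesis by simp
  qed
  have line: "real_distribution (distr L borel \<phi>)" if "L \<in> space (prob_algebra borel_S)" for L
    using that measurable_prob_borel_S[OF that continuous_\<phi>]
    by (auto simp: space_prob_algebra intro!: prob_space.real_distribution_distr)
  have "distr N borel \<phi> = distr N' borel \<phi>"
  proof (rule Levy_uniqueness)
    show "char (distr N borel \<phi>) = char (distr N' borel \<phi>)"
      unfolding fun_eq_iff char[OF N] char[OF N']
      by (auto intro!: arg_cong2[where f="(+)"] arg_cong2[where f="(*)"] eq cont)
  qed (use line N N' in auto)
  then show ?thesis
    using pull[OF N] pull[OF N'] by metis
qed

text \<open>
  Sequential weak compactness.  The images under \<open>\<phi>\<close> all live on one bounded interval, hence are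
  tight, and Helly selection gives a weak limit \<open>m'\<close> on the line.  The limit is carried by the
  closed set \<open>\<phi> ` S\<close>, so it can be pulled back to \<open>S\<close>.  A continuous \<open>f\<close> on \<open>S\<close> corresponds to a
  continuous function on \<open>\<phi> ` S\<close>, which Tietze's theorem extends to a bounded continuous function
  on the line; weak convergence applies to this extension.
\<close>
lemma weakly_convergent_subsequence:
  assumes \<mu>: "\<And>n. \<mu> n \<in> space (prob_algebra borel_S)"
  obtains s N where "strict_mono (s :: nat \<Rightarrow> nat)" "N \<in> space (prob_algebra borel_S)"
    "\<And>f :: 'a \<Rightarrow> real. continuous_on S f \<Longrightarrow> (\<lambda>n. \<integral>x. f x \<partial>\<mu> (s n)) \<longlonglongrightarrow> (\<integral>x. f x \<partial>N)"
proof -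
  define m where "m n = distr (\<mu> n) borel \<phi>" for n
  have \<phi>_measurable [measurable]: "\<phi> \<in> borel_measurable (\<mu> n)" for n
    by (rule measurable_prob_borel_S[OF \<mu> continuous_\<phi>])
  have m_real: "real_distribution (m n)" for n
    using \<mu>[of n] \<phi>_measurable[of n] unfolding m_def
    by (auto simp: space_prob_algebra intro!: prob_space.real_distribution_distr)
  obtain B where B: "0 \<le> B" "\<And>x. x \<in> S \<Longrightarrow> \<bar>\<phi> x\<bar> \<le> B"
    using continuous_bounded[OF continuous_\<phi>] by blast
  have tight: "tight m"
    unfolding tight_def
  proof (intro conjI allI impI m_real)
    fix \<epsilon> :: real assume "\<epsilon> > 0"
    have "measure (m n) {- B - 1<..B} = 1" for n
    proof -
      interpret prob_space "\<mu> n" using \<mu>[of n] by (simp add: space_prob_algebra)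
      have "\<phi> -` {- B - 1<..B} \<inter> space (\<mu> n) = space (\<mu> n)"
        using B(2) space_prob_borel_S[OF \<mu>] by force
      then show ?thesis
        by (simp add: m_def measure_distr prob_space)
    qed
    then show "\<exists>a b. a < b \<and> (\<forall>n. measure (m n) {a<..b} > 1 - \<epsilon>)"
      using B(1) \<open>\<epsilon> > 0\<close> by (intro exI[of _ "- B - 1"] exI[of _ B]) auto
  qed
  obtain s m' where s: "strict_mono s" and m': "real_distribution m'"
    and weak: "weak_conv_m (m \<circ> id \<circ> s) m'"
    using tight_imp_convergent_subsubsequence[OF tight strict_mono_id] by blast
  interpret m': real_distribution m' by fact
  have lim: "(\<lambda>n. \<integral>x. f (\<phi> x) \<partial>\<mu> (s n)) \<longlonglongrightarrow> (\<integral>t. f t \<partial>m')"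
    if f: "continuous_on UNIV f" and bdd: "\<And>t. norm (f t) \<le> C" for f :: "real \<Rightarrow> real" and C
  proof -
    have "(\<lambda>n. \<integral>t. f t \<partial>(m \<circ> id \<circ> s) n) \<longlonglongrightarrow> (\<integral>t. f t \<partial>m')"
      using f bdd
      by (intro weak_conv_imp_integral_bdd_continuous_conv[OF _ m' weak])
         (auto simp: m_real continuous_on_eq_continuous_at)
    moreover have "(\<integral>t. f t \<partial>m n) = (\<integral>x. f (\<phi> x) \<partial>\<mu> n)" for n
      unfolding m_def using f
      by (subst integral_distr) (auto intro: borel_measurable_continuous_onI)
    ultimately show ?thesis by simp
  qed
  let ?C = "\<phi> ` S"
  have AE_C: "AE t in m'. t \<in> ?C"
  proof -
    \<comment> \<open>The truncated distance to the image is a bounded continuous test function vanishing exactly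
      on the image; its integral against the limit is zero, so the limit charges nothing else.\<close>
    define d where "d t = min 1 (infdist t ?C)" for t :: real
    have d_cont: "continuous_on UNIV d"
      unfolding d_def by (intro continuous_intros)
    have d_bdd: "norm (d t) \<le> 1" for t
      unfolding d_def using infdist_nonneg[of t ?C] by auto
    have "(\<integral>x. d (\<phi> x) \<partial>\<mu> n) = 0" for n
    proof -
      have "(\<integral>x. d (\<phi> x) \<partial>\<mu> n) = (\<integral>x. 0 \<partial>\<mu> n)"
        by (rule Bochner_Integration.integral_cong)
           (auto simp: d_def space_prob_borel_S[OF \<mu>])
      then show ?thesis by simp
    qed
    then have "(\<integral>t. d t \<partial>m') = 0"
      using lim[OF d_cont d_bdd] by (simp add: LIMSEQ_const_iff)
    moreover have "integrable m' d"
      using d_bdd borel_measurable_continuous_onI[OF d_cont]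
      by (intro m'.integrable_const_bound[where B=1]) auto
    ultimately have "AE t in m'. d t = 0"
      by (subst (asm) integral_nonneg_eq_0_iff_AE) (auto simp: d_def infdist_nonneg)
    moreover have "d t = 0 \<Longrightarrow> t \<in> ?C" for t
      using in_closed_iff_infdist_zero[OF compact_imp_closed[OF compact_image_\<phi>]] nonempty_S
      by (auto simp: d_def min_def split: if_splits)
    ultimately show ?thesis by (auto elim!: eventually_mono)
  qed
  define N where "N = distr m' borel_S pull_back"
  have pull_back_m': "pull_back \<in> m' \<rightarrow>\<^sub>M borel_S"
    using measurable_pull_back by (simp cong: measurable_cong_sets)
  show thesis
  proof
    show "strict_mono s" by (rule s)
    show N: "N \<in> space (prob_algebra borel_S)"
      unfolding N_def using m'.prob_space_distr[OF pull_back_m']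
      by (simp add: space_prob_algebra)
    fix f :: "'a \<Rightarrow> real" assume f: "continuous_on S f"
    obtain C where C: "0 \<le> C" "\<And>x. x \<in> S \<Longrightarrow> \<bar>f x\<bar> \<le> C"
      using continuous_bounded[OF f] by blast
    have "continuous_on ?C (\<lambda>t. f (pull_back t))"
      using continuous_on_compose2[OF f continuous_pull_back] pull_back_in_S by blast
    then obtain g where g: "continuous_on UNIV g" "\<And>t. t \<in> ?C \<Longrightarrow> g t = f (pull_back t)"
        "\<And>t. norm (g t) \<le> C"
      using Tietze[of ?C "\<lambda>t. f (pull_back t)" UNIV C] C pull_back_in_S
        compact_imp_closed[OF compact_image_\<phi>] by auto
    have "(\<integral>x. f x \<partial>N) = (\<integral>t. f (pull_back t) \<partial>m')"
      unfolding N_def using measurable_continuous[OF f]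
      by (intro integral_distr pull_back_m')
    also have "\<dots> = (\<integral>t. g t \<partial>m')"
      using AE_C g(2) borel_measurable_continuous_onI[OF g(1)]
        measurable_compose[OF pull_back_m' measurable_continuous[OF f]]
      by (intro integral_cong_AE) (auto elim!: eventually_mono)
    finally have "(\<integral>x. f x \<partial>N) = (\<integral>t. g t \<partial>m')" .
    moreover have "(\<integral>x. g (\<phi> x) \<partial>\<mu> n) = (\<integral>x. f x \<partial>\<mu> n)" for n
      by (rule Bochner_Integration.integral_cong)
         (auto simp: g(2) pull_back_\<phi> space_prob_borel_S[OF \<mu>])
    ultimately show "(\<lambda>n. \<integral>x. f x \<partial>\<mu> (s n)) \<longlonglongrightarrow> (\<integral>x. f x \<partial>N)"
      using lim[OF g(1,3)] by simp
  qed
qed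

lemma integral_bind_continuous:
  fixes f :: "'a \<Rightarrow> real"
  assumes N: "finite_measure N" and P: "P \<in> N \<rightarrow>\<^sub>M prob_algebra borel_S" and f: "continuous_on S f"
  shows "(\<integral>y. f y \<partial>(N \<bind> P)) = (\<integral>x. (\<integral>y. f y \<partial>P x) \<partial>N)"
proof -
  obtain B where B: "\<And>x. x \<in> S \<Longrightarrow> \<bar>f x\<bar> \<le> B"
    using continuous_bounded[OF f] by blast
  have "AE x in N. emeasure (P x) (space (P x)) \<le> ennreal 1"
    using measurable_space[OF P]
    by (auto simp: space_prob_algebra prob_space.emeasure_space_1)
  then show ?thesis
    using N measurable_prob_algebraD[OF P] measurable_continuous[OF f] B
    by (intro integral_bind[where B=B and K=borel_S and B'=1]) (auto simp: space_restrict_space)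
qed

text \<open>
  The Krylov--Bogolyubov theorem.  The time averages of the laws \<open>\<nu> k\<close> of a Feller chain are
  almost invariant: applying the kernel to the average of the first \<open>n + 1\<close> laws replaces only one
  term, so integrals change by \<open>O(1 / n)\<close>.  A weak limit along a subsequence is therefore invariant,
  the Feller property being what allows the limit to be taken in integrals of \<open>P f\<close>.

  A continuous function whose integral is constant in time keeps this integral under averages and
  weak limits.  Both spatial invariance and the particle density will be transferred to
  the invariant measure in this way.
\<close>
theorem invariant_measure_with_conserved_integrals:
  fixes P :: "'a \<Rightarrow> 'a measure"
  assumes P: "P \<in> borel_S \<rightarrow>\<^sub>M prob_algebra borel_S"
    and feller: "\<And>f :: 'a \<Rightarrow> real. continuous_on S f \<Longrightarrow> continuous_on S (\<lambda>x. \<integral>y. f y \<partial>P x)"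
    and \<nu>0: "\<nu> 0 \<in> space (prob_algebra borel_S)"
    and \<nu>_Suc: "\<And>k. \<nu> (Suc k) = \<nu> k \<bind> P"
  obtains \<mu> where "\<mu> \<in> space (prob_algebra borel_S)" "\<mu> \<bind> P = \<mu>"
    "\<And>(f :: 'a \<Rightarrow> real) c. continuous_on S f \<Longrightarrow> (\<And>k. (\<integral>x. f x \<partial>\<nu> k) = c) \<Longrightarrow> (\<integral>x. f x \<partial>\<mu>) = c"
proof -
  have P_on: "P \<in> N \<rightarrow>\<^sub>M prob_algebra borel_S" if "N \<in> space (prob_algebra borel_S)" for N
    using P that measurable_cong_sets[of N borel_S] by (auto simp: space_prob_algebra)
  have fin: "finite_measure N" if "N \<in> space (prob_algebra borel_S)" for N
    using that by (simp add: space_prob_algebra prob_space.finite_measure)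
  have \<nu>: "\<nu> k \<in> space (prob_algebra borel_S)" for k
    by (induction k) (simp_all only: \<nu>0 \<nu>_Suc bind_in_space_prob_algebra[OF _ P])
  \<comment> \<open>Choosing the time uniformly at random from \<open>{..n}\<close> realises the Cesaro average as a mixture.\<close>
  define avg where "avg n = measure_pmf (pmf_of_set {..n}) \<bind> \<nu>" for n :: nat
  have \<nu>_kernel: "\<nu> \<in> measure_pmf p \<rightarrow>\<^sub>M prob_algebra borel_S" for p
    using \<nu> by (simp add: measurable_pmf_measure1 Pi_iff)
  have avg: "avg n \<in> space (prob_algebra borel_S)" for n
    unfolding avg_def
    by (rule bind_in_space_prob_algebra[OF _ \<nu>_kernel])
       (simp add: space_prob_algebra measure_pmf.prob_space_axioms)
  have integral_avg: "(\<integral>x. f x \<partial>avg n) = (\<Sum>k\<le>n. \<integral>x. f x \<partial>\<nu> k) / (real n + 1)"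
    if "continuous_on S f" for f :: "'a \<Rightarrow> real" and n
    unfolding avg_def
    by (subst integral_bind_continuous[OF _ \<nu>_kernel that])
       (auto simp: integral_pmf_of_set measure_pmf.finite_measure_axioms)
  obtain s \<mu> where s: "strict_mono (s :: nat \<Rightarrow> nat)" and \<mu>: "\<mu> \<in> space (prob_algebra borel_S)"
    and lim: "\<And>f :: 'a \<Rightarrow> real. continuous_on S f \<Longrightarrow>
                (\<lambda>n. \<integral>x. f x \<partial>avg (s n)) \<longlonglongrightarrow> (\<integral>x. f x \<partial>\<mu>)"
    using weakly_convergent_subsequence[of avg, OF avg] by metis
  show thesis
  proof
    show "\<mu> \<in> space (prob_algebra borel_S)" by (rule \<mu>)
    show "\<mu> \<bind> P = \<mu>"
    proof (rule prob_eqI_continuous[OF bind_in_space_prob_algebra[OF \<mu> P] \<mu>])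
      fix f :: "'a \<Rightarrow> real" assume f: "continuous_on S f"
      let ?Pf = "\<lambda>x. \<integral>y. f y \<partial>P x"
      obtain B where B: "\<And>x. x \<in> S \<Longrightarrow> \<bar>f x\<bar> \<le> B"
        using continuous_bounded[OF f] by blast
      have bdd: "\<bar>\<integral>x. f x \<partial>\<nu> k\<bar> \<le> B" for k
      proof -
        interpret prob_space "\<nu> k" using \<nu>[of k] by (simp add: space_prob_algebra)
        have "(\<integral>x. f x \<partial>\<nu> k) \<le> B"
          using B space_prob_borel_S[OF \<nu>]
          by (intro integral_le_const integrable_continuous[OF \<nu> f] AE_I2) (auto simp: abs_le_iff)
        moreover have "- B \<le> (\<integral>x. f x \<partial>\<nu> k)"
          using B space_prob_borel_S[OF \<nu>]
          by (intro integral_ge_const integrable_continuous[OF \<nu> f] AE_I2) (auto simp: abs_le_iff minus_le_iff)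
        ultimately show ?thesis by simp
      qed
      have step: "(\<integral>x. ?Pf x \<partial>\<nu> k) = (\<integral>x. f x \<partial>\<nu> (Suc k))" for k
        unfolding \<nu>_Suc by (rule integral_bind_continuous[OF fin[OF \<nu>] P_on[OF \<nu>] f, symmetric])
      have "(\<integral>x. ?Pf x \<partial>avg n) - (\<integral>x. f x \<partial>avg n)
          = ((\<integral>x. f x \<partial>\<nu> (Suc n)) - (\<integral>x. f x \<partial>\<nu> 0)) / (real n + 1)" for n
        unfolding integral_avg[OF f] integral_avg[OF feller[OF f]] step
        using sum_telescope[of "\<lambda>k. - (\<integral>x. f x \<partial>\<nu> k)" n]
        by (simp add: diff_divide_distrib[symmetric] sum_subtractf sum_negf)
      then have "norm ((\<integral>x. ?Pf x \<partial>avg n) - (\<integral>x. f x \<partial>avg n)) \<le> 2 * B / (real n + 1)" for n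
        using bdd[of "Suc n"] bdd[of 0]
        by (simp only: real_norm_def abs_divide) (rule frac_le; simp)
      then have "\<forall>\<^sub>F n in sequentially. norm ((\<integral>x. ?Pf x \<partial>avg n) - (\<integral>x. f x \<partial>avg n)) \<le> 2 * B / (real n + 1)"
        by (intro always_eventually allI)
      moreover have "(\<lambda>n. 2 * B / (real n + 1)) \<longlonglongrightarrow> 0"
        by real_asymp
      ultimately have "(\<lambda>n. (\<integral>x. ?Pf x \<partial>avg n) - (\<integral>x. f x \<partial>avg n)) \<longlonglongrightarrow> 0"
        by (rule Lim_null_comparison)
      from LIMSEQ_subseq_LIMSEQ[OF this s]
      have "(\<lambda>n. (\<integral>x. ?Pf x \<partial>avg (s n)) - (\<integral>x. f x \<partial>avg (s n))) \<longlonglongrightarrow> 0"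
        unfolding comp_def .
      moreover have "(\<lambda>n. (\<integral>x. ?Pf x \<partial>avg (s n)) - (\<integral>x. f x \<partial>avg (s n)))
          \<longlonglongrightarrow> (\<integral>x. ?Pf x \<partial>\<mu>) - (\<integral>x. f x \<partial>\<mu>)"
        by (intro tendsto_diff lim f feller)
      ultimately have "(\<integral>x. ?Pf x \<partial>\<mu>) - (\<integral>x. f x \<partial>\<mu>) = 0"
        by (rule LIMSEQ_unique[rotated])
      then show "(\<integral>x. f x \<partial>(\<mu> \<bind> P)) = (\<integral>x. f x \<partial>\<mu>)"
        by (simp add: integral_bind_continuous[OF fin[OF \<mu>] P_on[OF \<mu>] f])
    qed
    fix f :: "'a \<Rightarrow> real" and c
    assume f: "continuous_on S f" and c: "\<And>k. (\<integral>x. f x \<partial>\<nu> k) = c"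
    have "(\<integral>x. f x \<partial>avg n) = c" for n
    proof -
      have "(\<Sum>k\<le>n. \<integral>x. f x \<partial>\<nu> k) = c * (real n + 1)"
        by (simp add: c algebra_simps)
      then show ?thesis
        unfolding integral_avg[OF f] by simp
    qed
    then show "(\<integral>x. f x \<partial>\<mu>) = c"
      using lim[OF f] by (simp add: LIMSEQ_const_iff)
  qed
qed

end

section \<open>The configuration space as a compact subset of the line\<close>
lemma compact_configs: "compact (configs K :: 'd::finite config set)"
proof -
  have "(configs K :: 'd config set) = (\<Pi>\<^sub>E i\<in>UNIV. {..<K})"
    by (auto simp: configs_def)
  moreover have "compactin (product_topology (\<lambda>_. euclidean) (UNIV :: (int ^ 'd) set)) (\<Pi>\<^sub>E i\<in>UNIV. {..<K})"
    unfolding compactin_PiE by (auto intro: finite_imp_compact)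
  ultimately show ?thesis
    by (simp add: euclidean_product_topology)
qed

lemma continuous_on_site:
  fixes S :: "'d::finite config set"
  shows "continuous_on S (\<lambda>x. real (x i))"
proof -
  have "continuous_on S (\<lambda>x. x i)"
    using continuous_on_product_coordinates[of i] continuous_on_subset by blast
  then show ?thesis
    by (rule continuous_on_of_nat)
qed

text \<open>
  Sites are enumerated, and a configuration is read as the expansion of a real number in base
  \<open>K + 1\<close>.  Only the digits \<open>0, \<dots>, K - 1\<close> occur: with one digit of the base left out, no two
  different expansions have the same value.
\<close>
definition digit_code :: "nat \<Rightarrow> 'd::finite config \<Rightarrow> real" where
  "digit_code K x = (\<Sum>n. real (x (from_nat n)) * (1 / (real K + 1)) ^ n)"

lemma summable_digits:
  assumes "K \<ge> 1"
  shows "summable (\<lambda>n. c * (1 / (real K + 1)) ^ n)"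
  using assms by (intro summable_mult summable_geometric) auto

lemma continuous_digit_code:
  assumes "K \<ge> 1"
  shows "continuous_on (configs K :: 'd::finite config set) (digit_code K)"
proof -
  let ?f = "\<lambda>n (x :: 'd config). real (x (from_nat n)) * (1 / (real K + 1)) ^ n"
  have "uniform_limit (configs K) (\<lambda>n x. \<Sum>i<n. ?f i x) (\<lambda>x. \<Sum>i. ?f i x) sequentially"
  proof (rule Weierstrass_m_test[OF _ summable_digits[OF assms, of "real K"]])
    fix n and x :: "'d config" assume "x \<in> configs K"
    then have "real (x (from_nat n)) \<le> real K"
      by (auto simp: configs_def intro: less_imp_le)
    then show "norm (?f n x) \<le> real K * (1 / (real K + 1)) ^ n"
      by (auto simp: abs_mult intro!: divide_right_mono)
  qed
  then have "continuous_on (configs K) (\<lambda>x :: 'd config. \<Sum>i. ?f i x)"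
    by (rule uniform_limit_theorem[rotated])
       (auto intro!: always_eventually continuous_intros continuous_on_site)
  then show ?thesis
    by (simp add: digit_code_def[abs_def])
qed

text \<open>
  At the first place \<open>n\<close> where two configurations differ, the digits contribute a difference of at
  least \<open>b ^ n\<close> with \<open>b = 1 / (K + 1)\<close>.  The remaining digits can compensate at most
  \<open>(K - 1) * b ^ (n + 1) / (1 - b) = (K - 1) / K * b ^ n\<close>, which is strictly less.
\<close>
lemma inj_on_digit_code:
  assumes K: "K \<ge> 1"
  shows "inj_on (digit_code K) (configs K :: 'd::finite config set)"
proof (rule inj_onI, rule ccontr)
  fix x y :: "'d config"
  assume x: "x \<in> configs K" and y: "y \<in> configs K"
    and eq: "digit_code K x = digit_code K y" and "x \<noteq> y"
  define b where "b = 1 / (real K + 1)"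
  define z where "z n = real (x (from_nat n)) - real (y (from_nat n))" for n
  have b: "0 < b" "b < 1" "b / (1 - b) = 1 / real K"
    using K by (auto simp: b_def field_simps)
  have z_le: "\<bar>z n\<bar> \<le> real K - 1" for n
    using x y K unfolding z_def configs_def
    by (auto simp: abs_le_iff dest!: spec[of _ "from_nat n"])
  have summable_b: "summable (\<lambda>n. c * b ^ n)" for c
    using summable_digits[OF K] by (simp add: b_def)
  have summable_x: "summable (\<lambda>n. real (w (from_nat n)) * b ^ n)" if "w \<in> configs K" for w :: "'d config"
  proof (rule summable_comparison_test'[OF summable_b[of "real K"]])
    fix n
    have "real (w (from_nat n)) \<le> real K"
      using that by (auto simp: configs_def intro: less_imp_le)
    then show "norm (real (w (from_nat n)) * b ^ n) \<le> real K * b ^ n"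
      using b by (simp add: abs_mult mult_right_mono)
  qed
  have summable_z: "summable (\<lambda>n. z n * b ^ n)"
    using summable_diff[OF summable_x[OF x] summable_x[OF y]] by (simp add: z_def left_diff_distrib)
  have sum_z: "(\<Sum>n. z n * b ^ n) = 0"
    using suminf_diff[OF summable_x[OF x] summable_x[OF y]] eq
    by (simp add: z_def left_diff_distrib digit_code_def b_def)
  obtain i where "x i \<noteq> y i"
    using \<open>x \<noteq> y\<close> by blast
  then have "\<exists>n. z n \<noteq> 0"
    by (intro exI[of _ "to_nat i"]) (simp add: z_def)
  then obtain n where n: "z n \<noteq> 0" "\<And>m. m < n \<Longrightarrow> z m = 0"
    using exists_least_iff[of "\<lambda>n. z n \<noteq> 0"] by blast
  let ?tail = "\<Sum>m. z (m + Suc n) * b ^ (m + Suc n)"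
  have "?tail = - (z n * b ^ n)"
    using suminf_split_initial_segment[OF summable_z, of "Suc n"] sum_z n(2) by simp
  moreover have "1 \<le> \<bar>z n\<bar>"
    using n(1) unfolding z_def
    by (cases rule: linorder_cases[of "x (from_nat n)" "y (from_nat n)"]) auto
  ultimately have "b ^ n \<le> \<bar>?tail\<bar>"
    using b by (simp add: abs_mult)
  also have "\<dots> \<le> (\<Sum>m. ((real K - 1) * b ^ Suc n) * b ^ m)"
    unfolding real_norm_def[symmetric]
  proof (rule norm_suminf_le[OF _ summable_b])
    fix m
    have "\<bar>z (m + Suc n)\<bar> * b ^ (m + Suc n) \<le> (real K - 1) * b ^ (m + Suc n)"
      using b by (intro mult_right_mono z_le) auto
    then show "norm (z (m + Suc n) * b ^ (m + Suc n)) \<le> ((real K - 1) * b ^ Suc n) * b ^ m"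
      using b by (simp add: abs_mult power_add mult_ac)
  qed
  also have "\<dots> = (real K - 1) * b ^ n * (b / (1 - b))"
    using b(1,2) by (subst suminf_mult) (simp_all add: suminf_geometric summable_geometric)
  also have "\<dots> < b ^ n"
    unfolding b(3) using K b by (simp add: field_simps)
  finally show False by simp
qed

lemma compact_in_line_configs:
  assumes "K \<ge> 1"
  shows "compact_in_line (configs K :: 'd::finite config set) (digit_code K)"
proof
  have "(\<lambda>_. 0) \<in> (configs K :: 'd config set)"
    using assms by (auto simp: configs_def)
  then show "configs K \<noteq> ({} :: 'd config set)" by blast
qed (use assms compact_configs continuous_digit_code inj_on_digit_code in auto)

section \<open>Translations\<close>
lemma shift_shift: "shift l (shift m x) = shift (l + m) x"
  by (simp add: shift_def fun_eq_iff add.assoc)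

lemma shift_0: "shift 0 x = x"
  by (simp add: shift_def)

lemma shift_in_configs: "x \<in> configs K \<Longrightarrow> shift l x \<in> configs K"
  by (simp add: configs_def shift_def)

lemma space_config_space: "space (config_space K) = configs K"
  by (simp add: config_space_def space_restrict_space)

lemma continuous_on_shift: "continuous_on S (shift l)"
proof (rule continuous_on_coordinatewise_then_product)
  fix i
  show "continuous_on S (\<lambda>x. shift l x i)"
    unfolding shift_def
    using continuous_on_product_coordinates[of "i + l"] continuous_on_subset by blast
qed

lemma measurable_shift: "shift l \<in> config_space K \<rightarrow>\<^sub>M config_space K"
  unfolding config_space_def
  by (rule measurable_restrict_space2)
     (auto simp: space_restrict_space shift_in_configs
           intro: borel_measurable_continuous_on_restrict continuous_on_shift)

text \<open>
  Translation invariance is defined with \<open>\<mu>\<close> itself as the target space, whereas the results on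
  push-forwards and kernels use a fixed target space.
\<close>
lemma distr_self_cong:
  "sets \<mu> = sets M \<Longrightarrow> distr \<mu> \<mu> f = distr \<mu> M f"
  by (rule distr_cong) auto

text \<open>
  Translation invariance of the transition probabilities, restated for kernels: translating the
  outcome of a step amounts to translating its starting point.  In this form it composes with the
  Giry monad.
\<close>
lemma kernel_equivariant:
  assumes P: "P \<in> config_space K \<rightarrow>\<^sub>M prob_algebra (config_space K)"
    and inv: "translation_invariant_kernel K P" and x: "x \<in> configs K"
  shows "distr (P x) (config_space K) (shift l) = P (shift l x)"
proof -
  have P_x: "sets (P w) = sets (config_space K)" "prob_space (P w)" if "w \<in> configs K" for w
    using measurable_space[OF P, of w] that by (auto simp: space_prob_algebra space_config_space)
  note Px = P_x[OF x] and Psx = P_x[OF shift_in_configs[OF x, of l]]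
  have shift_Px: "shift l \<in> P x \<rightarrow>\<^sub>M config_space K"
    using measurable_shift Px(1) measurable_cong_sets by blast
  interpret Px: prob_space "P x" by (rule Px)
  interpret Psx: prob_space "P (shift l x)" by (rule Psx)
  interpret D: prob_space "distr (P x) (config_space K) (shift l)"
    by (rule Px.prob_space_distr[OF shift_Px])
  show ?thesis
  proof (rule measure_eqI)
    fix A assume "A \<in> sets (distr (P x) (config_space K) (shift l))"
    then have A: "A \<in> sets (config_space K)" by simp
    have sub: "A \<subseteq> configs K"
      using sets.sets_into_space[OF A] by (simp add: space_config_space)
    let ?B = "shift l -` A \<inter> configs K"
    have B: "?B \<in> sets (config_space K)"
      using measurable_sets[OF measurable_shift A] by (simp add: space_config_space)
    have "shift l ` ?B = A"
    proof
      show "A \<subseteq> shift l ` ?B"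
      proof
        fix y assume "y \<in> A"
        then have "shift (- l) y \<in> ?B" "y = shift l (shift (- l) y)"
          using sub by (auto simp: shift_shift shift_0 shift_in_configs)
        then show "y \<in> shift l ` ?B" by blast
      qed
    qed auto
    then have "measure (P x) ?B = measure (P (shift l x)) A"
      using inv x B unfolding translation_invariant_kernel_def by metis
    moreover have "measure (distr (P x) (config_space K) (shift l)) A = measure (P x) ?B"
      using sets_eq_imp_space_eq[OF Px(1)]
      by (simp add: measure_distr[OF shift_Px A] space_config_space)
    ultimately show "emeasure (distr (P x) (config_space K) (shift l)) A = emeasure (P (shift l x)) A"
      by (simp add: D.emeasure_eq_measure Psx.emeasure_eq_measure)
  qed (simp add: Psx)
qed

text \<open>
  Translating after a step is the same as translating before it, and translating \<open>\<mu>\<close> does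
  nothing.
\<close>
lemma translation_invariant_bind:
  assumes P: "P \<in> config_space K \<rightarrow>\<^sub>M prob_algebra (config_space K)"
    and inv: "translation_invariant_kernel K P"
    and \<mu>: "\<mu> \<in> space (prob_algebra (config_space K))"
    and \<mu>_inv: "translation_invariant \<mu>"
  shows "translation_invariant (\<mu> \<bind> P)"
  unfolding translation_invariant_def
proof
  fix l
  have sets_\<mu>: "sets \<mu> = sets (config_space K)" and "prob_space \<mu>"
    using \<mu> by (auto simp: space_prob_algebra)
  have space_\<mu>: "space \<mu> = configs K"
    using sets_eq_imp_space_eq[OF sets_\<mu>] by (simp add: space_config_space)
  have ne: "space \<mu> \<noteq> {}"
    using prob_space.not_empty[OF \<open>prob_space \<mu>\<close>] .
  note Psub = measurable_prob_algebraD[OF P]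
  have P\<mu>: "P \<in> \<mu> \<rightarrow>\<^sub>M subprob_algebra (config_space K)"
    using Psub sets_\<mu> measurable_cong_sets by blast
  have shift_\<mu>: "shift l \<in> \<mu> \<rightarrow>\<^sub>M config_space K"
    using measurable_shift sets_\<mu> measurable_cong_sets by blast
  have "distr (\<mu> \<bind> P) (\<mu> \<bind> P) (shift l) = distr (\<mu> \<bind> P) (config_space K) (shift l)"
    by (rule distr_self_cong) (rule sets_bind_measurable[OF P\<mu> ne])
  also have "\<dots> = \<mu> \<bind> (\<lambda>x. distr (P x) (config_space K) (shift l))"
    by (rule distr_bind[OF P\<mu> ne measurable_shift])
  also have "\<dots> = \<mu> \<bind> (\<lambda>x. P (shift l x))"
    by (rule bind_cong) (simp_all add: space_\<mu> kernel_equivariant[OF P inv])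
  also have "\<dots> = distr \<mu> (config_space K) (shift l) \<bind> P"
    by (rule bind_distr[OF shift_\<mu> Psub ne, symmetric])
  also have "distr \<mu> (config_space K) (shift l) = \<mu>"
    using \<mu>_inv distr_self_cong[OF sets_\<mu>] unfolding translation_invariant_def by metis
  finally show "distr (\<mu> \<bind> P) (\<mu> \<bind> P) (shift l) = \<mu> \<bind> P" .
qed

section \<open>Conservation of the particle density\<close>
definition cube :: "nat \<Rightarrow> (int ^ 'd::finite) set" where
  "cube n = {l. sup_abs l \<le> int n}"

lemma sup_abs_le_iff: "sup_abs l \<le> m \<longleftrightarrow> (\<forall>c. \<bar>l $ c\<bar> \<le> m)"
  unfolding sup_abs_def by (subst Max_le_iff) auto

lemma sup_abs_uminus: "sup_abs (- l) = sup_abs l"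
  by (simp add: sup_abs_def)

lemma sup_abs_add_le: "sup_abs (a + b) \<le> sup_abs a + sup_abs b"
proof -
  have "\<bar>a $ c\<bar> \<le> sup_abs a" "\<bar>b $ c\<bar> \<le> sup_abs b" for c
    using sup_abs_le_iff[of a] sup_abs_le_iff[of b] by blast+
  then have "\<bar>a $ c + b $ c\<bar> \<le> sup_abs a + sup_abs b" for c
    using abs_triangle_ineq add_mono order_trans by metis
  then show ?thesis
    by (simp add: sup_abs_le_iff)
qed

lemma card_cube: "card (cube n :: (int ^ 'd::finite) set) = (2 * n + 1) ^ CARD('d)"
  and finite_cube: "finite (cube n :: (int ^ 'd::finite) set)"
proof -
  have bij: "bij_betw vec_nth (cube n :: (int ^ 'd) set) (\<Pi>\<^sub>E c\<in>UNIV. {- int n..int n})"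
    by (rule bij_betwI[where g=vec_lambda])
       (auto simp: cube_def sup_abs_le_iff abs_le_iff minus_le_iff PiE_UNIV_domain Pi_iff)
  have "nat (2 * int n + 1) = 2 * n + 1" by linarith
  then show "card (cube n :: (int ^ 'd) set) = (2 * n + 1) ^ CARD('d)"
    using bij_betw_same_card[OF bij] by (simp add: card_PiE del: nat_1_add_1)
  show "finite (cube n :: (int ^ 'd) set)"
    using bij_betw_finite[OF bij] by (simp add: finite_PiE)
qed

text \<open>
  Particles are conserved and move by at most \<open>V\<close>.  Hence every particle found in a cube after a
  step started in the cube enlarged by \<open>V\<close>, and every particle that starts in a cube is found in the
  enlarged cube.
\<close>
lemma particle_count_in_cubes:
  fixes x :: "'d::finite config"
  assumes v: "\<And>p. sup_abs (v p) \<le> int V"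
  shows "(\<Sum>j\<in>cube n. move_particles adm v x j) \<le> (\<Sum>i\<in>cube (n + V). x i)"
    and "(\<Sum>i\<in>cube n. x i) \<le> (\<Sum>j\<in>cube (n + V). move_particles adm v x j)"
proof -
  define arriving where "arriving j = {(i, k). k < x i \<and> new_site adm v x (i, k) = j}" for j
  define starting where "starting m = (SIGMA i:cube m. {..<x i})" for m
  have displacement: "sup_abs (new_site adm v x (i, k) - i) \<le> int V" for i k
    using v[of "(i, k)"] by (auto simp: new_site_def sup_abs_def)
  have to_cube: "new_site adm v x (i, k) \<in> cube (m + V)" if "i \<in> cube m" for i k m
    using that displacement[of i k] sup_abs_add_le[of i "new_site adm v x (i, k) - i"]
    by (simp add: cube_def)
  have from_cube: "i \<in> cube (m + V)" if "new_site adm v x (i, k) \<in> cube m" for i k m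
    using that displacement[of i k] sup_abs_uminus[of "new_site adm v x (i, k) - i"]
      sup_abs_add_le[of "new_site adm v x (i, k)" "i - new_site adm v x (i, k)"]
    by (simp add: cube_def)
  have finite_starting: "finite (starting m)" for m
    by (simp add: starting_def finite_cube)
  have card_starting: "card (starting m) = (\<Sum>i\<in>cube m. x i)" for m
    unfolding starting_def by (subst card_SigmaI) (simp_all add: finite_cube)
  have arriving_sub: "arriving j \<subseteq> starting (m + V)" if "j \<in> cube m" for j m
    using that from_cube by (auto simp: arriving_def starting_def)
  have card_arriving: "card (\<Union>j\<in>cube m. arriving j) = (\<Sum>j\<in>cube m. move_particles adm v x j)" for m
    unfolding move_particles_def arriving_def[symmetric]
    by (rule card_UN_disjoint)
       (use finite_cube finite_subset[OF arriving_sub finite_starting] in \<open>auto simp: arriving_def\<close>)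
  have "card (\<Union>j\<in>cube n. arriving j) \<le> card (starting (n + V))"
    using arriving_sub by (intro card_mono finite_starting UN_least)
  then show "(\<Sum>j\<in>cube n. move_particles adm v x j) \<le> (\<Sum>i\<in>cube (n + V). x i)"
    by (simp add: card_arriving card_starting)
  have "card (starting n) \<le> card (\<Union>j\<in>cube (n + V). arriving j)"
  proof (rule card_mono)
    show "finite (\<Union>j\<in>cube (n + V). arriving j)"
      using finite_cube finite_subset[OF arriving_sub finite_starting] by blast
    show "starting n \<subseteq> (\<Union>j\<in>cube (n + V). arriving j)"
      using to_cube by (auto simp: starting_def arriving_def)
  qed
  then show "(\<Sum>i\<in>cube n. x i) \<le> (\<Sum>j\<in>cube (n + V). move_particles adm v x j)"
    by (simp add: card_arriving card_starting)
qed

definition cube_sum :: "nat \<Rightarrow> 'd::finite config \<Rightarrow> real" where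
  "cube_sum n x = (\<Sum>i\<in>cube n. real (x i))"

lemma continuous_on_cube_sum: "continuous_on S (cube_sum n)"
  unfolding cube_sum_def by (intro continuous_intros continuous_on_site)

text \<open>
  The counting bounds hold for every velocity field.  Imposing them therefore does not shrink the
  event that the new configuration lies in \<open>configs K\<close>, and this event has probability one because
  \<open>P x\<close> is a probability measure.
\<close>
lemma AE_cube_sums:
  fixes P :: "'d::finite config \<Rightarrow> 'd config measure"
  assumes sys: "particle_system K V P" and x: "x \<in> configs K"
  shows "AE y in P x. cube_sum n y \<le> cube_sum (n + V) x \<and> cube_sum n x \<le> cube_sum (n + V) y"
proof -
  let ?good = "\<lambda>y. cube_sum n y \<le> cube_sum (n + V) x \<and> cube_sum n x \<le> cube_sum (n + V) y"
  obtain Q adm where Q: "sets Q = sets (velocity_space V)"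
    and PQ: "\<And>A. A \<in> sets (config_space K) \<Longrightarrow>
               measure (P x) A = measure Q {v \<in> space Q. move_particles adm v x \<in> A}"
    using sys x unfolding particle_system_def by blast
  have P: "P x \<in> space (prob_algebra (config_space K))"
  proof (rule measurable_space[where f=P and M="config_space K"])
    show "P \<in> config_space K \<rightarrow>\<^sub>M prob_algebra (config_space K)"
      using sys by (simp add: particle_system_def markov_kernel_def)
  qed (simp add: x space_config_space)
  interpret prob_space "P x" using P by (simp add: space_prob_algebra)
  have sets_P: "sets (P x) = sets (config_space K)"
    using P by (simp add: space_prob_algebra)
  have space_P: "space (P x) = configs K"
    using sets_eq_imp_space_eq[OF sets_P] by (simp add: space_config_space)
  have cube_sum_meas [measurable]: "cube_sum m \<in> borel_measurable (config_space K)" for m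
    unfolding config_space_def
    by (intro borel_measurable_continuous_on_restrict continuous_on_cube_sum)
  let ?A = "{y \<in> space (config_space K). ?good y}"
  have A: "?A \<in> sets (config_space K)" by measurable
  have good: "?good (move_particles adm v x)" if "v \<in> space Q" for v
  proof -
    have "sup_abs (v p) \<le> int V" for p
      using that sets_eq_imp_space_eq[OF Q] by (auto simp: velocity_space_def space_PiM)
    from particle_count_in_cubes[where v=v and V=V and adm=adm and x=x and n=n, OF this] show ?thesis
      unfolding cube_sum_def of_nat_sum[symmetric] by (simp only: of_nat_le_iff)
  qed
  have "prob ?A = prob (configs K)"
  proof -
    have "{v \<in> space Q. move_particles adm v x \<in> ?A}
        = {v \<in> space Q. move_particles adm v x \<in> configs K}"
      using good by (auto simp: space_config_space)
    moreover have "configs K \<in> sets (config_space K :: 'd config measure)"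
      using sets.top[of "config_space K :: 'd config measure"] by (simp add: space_config_space)
    ultimately show ?thesis
      using PQ[OF A] PQ[of "configs K"] by (simp only:)
  qed
  then have "prob ?A = 1"
    using prob_space by (simp add: space_P)
  then have "AE y in P x. y \<in> ?A"
    using A sets_P by (subst (asm) prob_eq_1) auto
  then show ?thesis
    by (rule AE_mp) auto
qed

text \<open>
  The volume of the layer of width \<open>V\<close> around a cube is negligible compared with that of the cube.
\<close>
lemma le_if_cube_bounds:
  fixes a b :: real
  assumes "\<And>n. real ((2 * n + 1) ^ d) * a \<le> real ((2 * (n + V) + 1) ^ d) * b"
  shows "a \<le> b"
proof -
  have "(\<lambda>n. ((2 * (real n + real V) + 1) / (2 * real n + 1)) ^ d * b) \<longlonglongrightarrow> 1 ^ d * b"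
    by (intro tendsto_intros) real_asymp
  moreover have "a \<le> ((2 * (real n + real V) + 1) / (2 * real n + 1)) ^ d * b" for n
    using assms[of n] by (simp add: power_divide field_simps)
  ultimately show ?thesis
    by (intro LIMSEQ_le_const[where a=a]) auto
qed

lemma integral_cube_sum:
  fixes \<mu> :: "'d::finite config measure"
  assumes K: "K \<ge> 1" and \<mu>: "\<mu> \<in> space (prob_algebra (config_space K))"
    and inv: "translation_invariant \<mu>"
  shows "(\<integral>x. cube_sum n x \<partial>\<mu>) = real ((2 * n + 1) ^ CARD('d)) * particle_density \<mu>"
proof -
  interpret compact_in_line "configs K :: 'd config set" "digit_code K"
    by (rule compact_in_line_configs[OF K])
  note \<mu>' = \<mu>[unfolded config_space_def]
  have "(\<integral>x. real (x i) \<partial>\<mu>) = particle_density \<mu>" for i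
  proof -
    have meas: "shift i \<in> \<mu> \<rightarrow>\<^sub>M \<mu>"
      using measurable_shift[of i K] \<mu> measurable_cong_sets[of \<mu> "config_space K" \<mu> "config_space K"]
      by (auto simp: space_prob_algebra)
    have "particle_density \<mu> = (\<integral>x. real (x 0) \<partial>(distr \<mu> \<mu> (shift i)))"
      using inv by (simp add: translation_invariant_def particle_density_def)
    also have "\<dots> = (\<integral>x. real (shift i x 0) \<partial>\<mu>)"
      by (rule integral_distr[OF meas measurable_prob_borel_S[OF \<mu>' continuous_on_site]])
    finally show ?thesis by (simp add: shift_def)
  qed
  then show ?thesis
    unfolding cube_sum_def
    by (subst Bochner_Integration.integral_sum)
       (auto intro: integrable_continuous[OF \<mu>' continuous_on_site] simp: card_cube)
qed

text \<open>
  Averaged over a large cube, the particle numbers before and after a step differ only by what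
  crosses the boundary layer.  For translation invariant measures the expected number in a cube is
  the density times the volume, so letting the cube grow gives both inequalities between the
  two densities.
\<close>
lemma particle_density_bind:
  fixes P :: "'d::finite config \<Rightarrow> 'd config measure"
  assumes K: "K \<ge> 1" and sys: "particle_system K V P" and inv: "translation_invariant_kernel K P"
    and \<mu>: "\<mu> \<in> space (prob_algebra (config_space K))" and \<mu>_inv: "translation_invariant \<mu>"
  shows "particle_density (\<mu> \<bind> P) = particle_density \<mu>"
proof -
  interpret compact_in_line "configs K :: 'd config set" "digit_code K"
    by (rule compact_in_line_configs[OF K])
  have P: "P \<in> config_space K \<rightarrow>\<^sub>M prob_algebra (config_space K)"
    using sys by (simp add: particle_system_def markov_kernel_def)
  have \<mu>P: "\<mu> \<bind> P \<in> space (prob_algebra (config_space K))"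
    by (rule bind_in_space_prob_algebra[OF \<mu> P])
  note \<mu>' = \<mu>[unfolded config_space_def] and \<mu>P' = \<mu>P[unfolded config_space_def]
  have P\<mu>: "P \<in> \<mu> \<rightarrow>\<^sub>M prob_algebra borel_S"
    using P \<mu> measurable_cong_sets[of \<mu> "config_space K"]
    by (auto simp: space_prob_algebra config_space_def)
  interpret \<mu>: prob_space \<mu> using \<mu> by (simp add: space_prob_algebra)
  have Px: "P x \<in> space (prob_algebra borel_S)" if "x \<in> configs K" for x
    using measurable_space[OF P, of x] that by (simp add: space_config_space flip: config_space_def)
  have int_cube: "(\<integral>x. cube_sum m x \<partial>(\<mu> \<bind> P)) = (\<integral>x. (\<integral>y. cube_sum m y \<partial>P x) \<partial>\<mu>)" for m
    by (rule integral_bind_continuous[OF \<mu>.finite_measure_axioms P\<mu> continuous_on_cube_sum])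
  have pointwise: "(\<integral>y. cube_sum n y \<partial>P x) \<le> cube_sum (n + V) x"
      "cube_sum n x \<le> (\<integral>y. cube_sum (n + V) y \<partial>P x)" if x: "x \<in> configs K" for n x
  proof -
    interpret Px: prob_space "P x" using Px[OF x] by (simp add: space_prob_algebra)
    show "(\<integral>y. cube_sum n y \<partial>P x) \<le> cube_sum (n + V) x"
      using AE_cube_sums[OF sys x, of n]
      by (intro Px.integral_le_const integrable_continuous[OF Px[OF x] continuous_on_cube_sum])
         (auto elim: eventually_mono)
    show "cube_sum n x \<le> (\<integral>y. cube_sum (n + V) y \<partial>P x)"
      using AE_cube_sums[OF sys x, of n]
      by (intro Px.integral_ge_const integrable_continuous[OF Px[OF x] continuous_on_cube_sum])
         (auto elim: eventually_mono)
  qed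
  have integrable_inner: "integrable \<mu> (\<lambda>x. \<integral>y. cube_sum m y \<partial>P x)" for m
  proof (rule \<mu>.integrable_const_bound)
    show "(\<lambda>x. \<integral>y. cube_sum m y \<partial>P x) \<in> borel_measurable \<mu>"
      using measurable_prob_algebraD[OF P\<mu>]
      by (rule measurable_compose[OF _ integral_measurable_subprob_algebra])
         (rule measurable_continuous[OF continuous_on_cube_sum])
  next
    show "AE x in \<mu>. norm (\<integral>y. cube_sum m y \<partial>P x) \<le> real (card (cube (m + V) :: (int ^ 'd) set)) * real K"
    proof (rule AE_I2)
      fix x assume "x \<in> space \<mu>"
      then have x: "x \<in> configs K" by (simp add: space_prob_borel_S[OF \<mu>'])
      have "0 \<le> (\<integral>y. cube_sum m y \<partial>P x)"
        by (rule Bochner_Integration.integral_nonneg) (simp add: cube_sum_def sum_nonneg)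
      moreover have "cube_sum (m + V) x \<le> real (card (cube (m + V) :: (int ^ 'd) set)) * real K"
        unfolding cube_sum_def using x
        by (intro sum_bounded_above) (auto simp: configs_def intro: less_imp_le)
      ultimately show "norm (\<integral>y. cube_sum m y \<partial>P x) \<le> real (card (cube (m + V) :: (int ^ 'd) set)) * real K"
        using pointwise(1)[OF x, of m] by simp
    qed
  qed
  note integrable_cube = integrable_continuous[OF \<mu>' continuous_on_cube_sum]
  note integrals = integral_cube_sum[OF K \<mu> \<mu>_inv]
    integral_cube_sum[OF K \<mu>P translation_invariant_bind[OF P inv \<mu> \<mu>_inv]]
  show ?thesis
  proof (rule antisym; rule le_if_cube_bounds[where d="CARD('d)" and V=V])
    fix n
    have "(\<integral>x. cube_sum n x \<partial>(\<mu> \<bind> P)) \<le> (\<integral>x. cube_sum (n + V) x \<partial>\<mu>)"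
      unfolding int_cube using pointwise(1) space_prob_borel_S[OF \<mu>']
      by (intro integral_mono integrable_inner integrable_cube) auto
    then show "real ((2 * n + 1) ^ CARD('d)) * particle_density (\<mu> \<bind> P)
        \<le> real ((2 * (n + V) + 1) ^ CARD('d)) * particle_density \<mu>"
      unfolding integrals .
    have "(\<integral>x. cube_sum n x \<partial>\<mu>) \<le> (\<integral>x. cube_sum (n + V) x \<partial>(\<mu> \<bind> P))"
      unfolding int_cube using pointwise(2) space_prob_borel_S[OF \<mu>']
      by (intro integral_mono integrable_inner integrable_cube) auto
    then show "real ((2 * n + 1) ^ CARD('d)) * particle_density \<mu>
        \<le> real ((2 * (n + V) + 1) ^ CARD('d)) * particle_density (\<mu> \<bind> P)"
      unfolding integrals .
  qed
qed

section \<open>Existence of the invariant measure\<close>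
text \<open>
  A mixture of the point masses at the empty configuration and at the full one, each of
  which is fixed by all translations, already reaches every density.
\<close>
lemma translation_invariant_with_density:
  fixes r :: real
  assumes K: "K \<ge> 1" and r: "r \<in> {0..real K - 1}"
  obtains \<mu> :: "'d::finite config measure"
  where "\<mu> \<in> space (prob_algebra (config_space K))" "translation_invariant \<mu>"
    "particle_density \<mu> = r"
proof
  \<comment> \<open>For \<open>K = 1\<close> the only density is \<open>r = 0\<close>, and \<open>0 / 0 = 0\<close> is an acceptable weight.\<close>
  define p where "p = r / (real K - 1)"
  have p: "0 \<le> p" "p \<le> 1" "p * (real K - 1) = r"
    using r by (auto simp: p_def divide_le_eq_1)
  define c :: "bool \<Rightarrow> 'd config" where "c b = (\<lambda>_. if b then K - 1 else 0)" for b
  define \<mu> where "\<mu> = distr (measure_pmf (bernoulli_pmf p)) (config_space K) c"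
  have c: "c \<in> measure_pmf (bernoulli_pmf p) \<rightarrow>\<^sub>M config_space K"
    using K by (auto simp: c_def space_config_space configs_def)
  show \<mu>: "\<mu> \<in> space (prob_algebra (config_space K))"
    unfolding \<mu>_def using measure_pmf.prob_space_distr[OF c] by (simp add: space_prob_algebra)
  have shift_c: "shift l (c b) = c b" for l b
    by (simp add: shift_def c_def)
  have "distr \<mu> \<mu> (shift l) = \<mu>" for l
  proof -
    have "distr \<mu> \<mu> (shift l) = distr \<mu> (config_space K) (shift l)"
      by (rule distr_self_cong) (simp add: \<mu>_def)
    also have "\<dots> = \<mu>"
      unfolding \<mu>_def by (subst distr_distr[OF measurable_shift c]) (simp add: comp_def shift_c)
    finally show ?thesis .
  qed
  then show "translation_invariant \<mu>"
    by (simp add: translation_invariant_def)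
  have "(\<lambda>x. real (x 0)) \<in> borel_measurable (config_space K :: 'd config measure)"
    unfolding config_space_def
    by (intro borel_measurable_continuous_on_restrict continuous_on_site)
  then have "particle_density \<mu> = (\<integral>b. real (c b 0) \<partial>bernoulli_pmf p)"
    unfolding particle_density_def \<mu>_def by (rule integral_distr[OF c])
  also have "\<dots> = r"
    using p K by (simp add: c_def of_nat_diff mult.commute)
  finally show "particle_density \<mu> = r" .
qed

text \<open>
  Translation invariance is encoded by the vanishing integrals of \<open>f (shift l x) - f x\<close> for
  continuous \<open>f\<close>, and the density by the integral of the continuous function \<open>x 0\<close>.  Both are
  constant along the chain started from the mixture above, hence are inherited by the
  Krylov--Bogolyubov limit.
\<close>
theorem lemma6p1:
  fixes K V :: nat
    and P :: "'d::finite config \<Rightarrow> 'd config measure"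
    and r :: real
  assumes "K \<ge> 1"
    and "particle_system K V P"
    and "translation_invariant_kernel K P"
    and "feller K P"
    and "r \<in> {0..real K - 1}"
  shows "\<exists>\<mu>. config_prob K \<mu> \<and> translation_invariant \<mu> \<and> time_invariant P \<mu> \<and>
           particle_density \<mu> = r"
proof -
  interpret compact_in_line "configs K :: 'd config set" "digit_code K"
    by (rule compact_in_line_configs[OF assms(1)])
  have P: "P \<in> config_space K \<rightarrow>\<^sub>M prob_algebra (config_space K)"
    using assms(2) by (simp add: particle_system_def markov_kernel_def)
  have feller: "continuous_on (configs K) (\<lambda>x. \<integral>y. f y \<partial>P x)"
    if "continuous_on (configs K) f" for f :: "'d config \<Rightarrow> real"
    using assms(4) that compact_imp_bounded[OF compact_continuous_image[OF that compact_configs]]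
    by (simp add: feller_def)
  obtain \<mu>0 :: "'d config measure"
    where \<mu>0: "\<mu>0 \<in> space (prob_algebra (config_space K))" "translation_invariant \<mu>0"
      "particle_density \<mu>0 = r"
    using translation_invariant_with_density[OF assms(1,5)] by blast
  define \<nu> where "\<nu> k = ((\<lambda>N. N \<bind> P) ^^ k) \<mu>0" for k
  have \<nu>: "\<nu> k \<in> space (prob_algebra (config_space K)) \<and> translation_invariant (\<nu> k)
      \<and> particle_density (\<nu> k) = r" for k
  proof (induction k)
    case 0
    show ?case using \<mu>0 by (simp add: \<nu>_def)
  next
    case (Suc k)
    have "\<nu> (Suc k) = \<nu> k \<bind> P" by (simp add: \<nu>_def)
    then show ?case
      using Suc bind_in_space_prob_algebra[OF _ P] translation_invariant_bind[OF P assms(3)]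
        particle_density_bind[OF assms(1,2,3)] by simp
  qed
  obtain \<mu> where \<mu>: "\<mu> \<in> space (prob_algebra (config_space K))" and time: "\<mu> \<bind> P = \<mu>"
    and conserved: "\<And>(f :: 'd config \<Rightarrow> real) c. continuous_on (configs K) f \<Longrightarrow>
      (\<And>k. (\<integral>x. f x \<partial>\<nu> k) = c) \<Longrightarrow> (\<integral>x. f x \<partial>\<mu>) = c"
  proof (rule invariant_measure_with_conserved_integrals[of P \<nu>, folded config_space_def])
    show "\<nu> (Suc k) = \<nu> k \<bind> P" for k by (simp add: \<nu>_def)
  qed (use P feller \<nu> in auto)
  have shift_meas: "shift l \<in> N \<rightarrow>\<^sub>M config_space K" if "N \<in> space (prob_algebra (config_space K))" for N l
    using measurable_shift[of l K] that measurable_cong_sets[of N "config_space K"]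
    by (auto simp: space_prob_algebra)
  have integral_shift: "(\<integral>x. f x \<partial>distr N (config_space K) (shift l)) = (\<integral>x. f (shift l x) \<partial>N)"
    if "N \<in> space (prob_algebra (config_space K))" "continuous_on (configs K) f"
    for N l and f :: "'d config \<Rightarrow> real"
    using measurable_continuous[OF that(2)]
    by (intro integral_distr shift_meas that) (simp add: config_space_def)
  have "distr \<mu> \<mu> (shift l) = \<mu>" for l
  proof -
    have "distr \<mu> (config_space K) (shift l) = \<mu>"
    proof (rule prob_eqI_continuous[folded config_space_def])
      show "distr \<mu> (config_space K) (shift l) \<in> space (prob_algebra (config_space K))"
        using \<mu> prob_space.prob_space_distr[OF _ shift_meas[OF \<mu>]] by (simp add: space_prob_algebra)
      fix f :: "'d config \<Rightarrow> real" assume f: "continuous_on (configs K) f"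
      have fs: "continuous_on (configs K) (\<lambda>x. f (shift l x))"
        by (rule continuous_on_compose2[OF f continuous_on_shift]) (auto intro: shift_in_configs)
      have diff: "(\<integral>x. f (shift l x) - f x \<partial>N) = (\<integral>x. f (shift l x) \<partial>N) - (\<integral>x. f x \<partial>N)"
        if "N \<in> space (prob_algebra (config_space K))" for N
        using that f fs integrable_continuous[folded config_space_def]
        by (intro Bochner_Integration.integral_diff) auto
      have "(\<integral>x. f (shift l x) - f x \<partial>\<nu> k) = 0" for k
      proof -
        have "sets (\<nu> k) = sets (config_space K)" "distr (\<nu> k) (\<nu> k) (shift l) = \<nu> k"
          using \<nu>[of k] by (auto simp: space_prob_algebra translation_invariant_def)
        then have "distr (\<nu> k) (config_space K) (shift l) = \<nu> k"
          using distr_self_cong by metis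
        then show ?thesis
          using diff \<nu>[of k] integral_shift[of "\<nu> k" f l] f by simp
      qed
      then have "(\<integral>x. f (shift l x) - f x \<partial>\<mu>) = 0"
        by (intro conserved continuous_on_diff fs f)
      then show "(\<integral>x. f x \<partial>distr \<mu> (config_space K) (shift l)) = (\<integral>x. f x \<partial>\<mu>)"
        using diff[OF \<mu>] integral_shift[OF \<mu> f] by simp
    qed (rule \<mu>)
    then show ?thesis
      using distr_self_cong[of \<mu> "config_space K" "shift l"] \<mu> by (simp add: space_prob_algebra)
  qed
  then have "translation_invariant \<mu>"
    by (simp add: translation_invariant_def)
  moreover have "particle_density \<mu> = r"
    unfolding particle_density_def
    using \<nu> by (intro conserved continuous_on_site) (simp add: particle_density_def)
  ultimately show ?thesis
    using \<mu> time by (auto simp: config_prob_def time_invariant_def space_prob_algebra)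
qed

end
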